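(* Let $0<\rho<1$, let $\Omega=\{z\in\mathbb{C}:\rho<|z|<1\}$ be the annulus with boundary $\Gamma$, and let $S(z,a)$ be the Szegő kernel for $\Omega$. Put $$\lambda=\frac12+\frac{i\pi}{2\ln\rho}.$$ Then for all $a\in\Omega$ and $z\in\Omega\cup\Gamma$, $$S(z,a)=\frac{[\Gamma_{\rho^2}(\lambda)]^2}{2\pi(1-\rho^2)^{2(1-\lambda)}}\,\frac{\theta(-\rho\overline{a}z;\rho^2)}{\theta(\overline{a}z;\rho^2)}.$$
   Context: The Szegő kernel $S(z,a)$ for $\Omega$ is the reproducing kernel of the Hardy space $H^2(\Gamma)$, where $\Gamma$ consists of the circles $|z|=1$ and $|z|=\rho$ and the inner product is $\langle f,g\rangle=\int_\Gamma f\,\overline{g}\,|dz|$ with $|dz|$ arc length measure. An orthonormal basis of $H^2(\Gamma)$ is $\{z^n/\sqrt{2\pi(1+\rho^{2n+1})}\}_{n\in\mathbb{Z}}$, so that (known) $$S(z,a)=\frac{1}{2\pi}\sum_{n=-\infty}^{\infty}\frac{(z\overline{a})^n}{1+\rho^{2n+1}},\qquad a\in\Omega,\ z\in\Omega\cup\Gamma.$$ For $0<q<1$ and $\alpha\in\mathbb{C}$, $(\alpha;q)_\infty=\prod_{n=0}^\infty(1-\alpha q^n)$. The $q$-gamma (basic gamma) function is $$\Gamma_q(x)=\frac{(q;q)_\infty}{(q^x;q)_\infty}(1-q)^{1-x},$$ for complex $x$ with $(q^x;q)_\infty\neq0$, where for a positive real $c$ and complex $x$, $c^x=e^{x\ln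 c}$. The modified Jacobi theta function is $\theta(x;q)=(x;q)_\infty(q/x;q)_\infty$ for $x\ne0$. *)

theory Defs
  imports "HOL-Complex_Analysis.Complex_Analysis"
begin

definition annulus :: "real \<Rightarrow> complex set" where
  "annulus \<rho> = {z. \<rho> < norm z \<and> norm z < 1}"

definition annulus_boundary :: "real \<Rightarrow> complex set" where
  "annulus_boundary \<rho> = sphere 0 1 \<union> sphere 0 \<rho>"

text \<open>Integration over the boundary with respect to arc length; on a circle of radius \<open>r\<close>,
  parametrised by the angle \<open>t\<close>, arc length is \<open>r dt\<close>.\<close>

definition arc_integral ::
    "real \<Rightarrow> (complex \<Rightarrow> 'b::{banach, second_countable_topology}) \<Rightarrow> 'b" where
  "arc_integral \<rho> f =
     integral\<^sup>L (lebesgue_on {0..2*pi}) (\<lambda>t. f (cis t)) +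
     \<rho> *\<^sub>R integral\<^sup>L (lebesgue_on {0..2*pi}) (\<lambda>t. f (of_real \<rho> * cis t))"

definition L2_boundary :: "real \<Rightarrow> (complex \<Rightarrow> complex) set" where
  "L2_boundary \<rho> = {f. \<forall>r\<in>{1, \<rho>}.
     (\<lambda>t. f (of_real r * cis t)) \<in> borel_measurable (lebesgue_on {0..2*pi}) \<and>
     integrable (lebesgue_on {0..2*pi}) (\<lambda>t. (norm (f (of_real r * cis t)))\<^sup>2)}"

definition boundary_inner :: "real \<Rightarrow> (complex \<Rightarrow> complex) \<Rightarrow> (complex \<Rightarrow> complex) \<Rightarrow> complex" where
  "boundary_inner \<rho> f g = arc_integral \<rho> (\<lambda>z. f z * cnj (g z))"

definition annulus_algebra :: "real \<Rightarrow> (complex \<Rightarrow> complex) set" where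
  "annulus_algebra \<rho> =
     {h. h holomorphic_on annulus \<rho> \<and> continuous_on (annulus \<rho> \<union> annulus_boundary \<rho>) h}"

text \<open>The Hardy space is the closure in \<open>L\<^sup>2\<close> of the boundary of the functions that are
  holomorphic in the annulus and continuous up to the boundary. An element is represented by one
  function on the closed annulus: its restriction to the boundary is (a representative of) the
  \<open>L\<^sup>2\<close> function, and its restriction to the open annulus is the holomorphic extension. By the
  Cauchy integral formula, \<open>L\<^sup>2\<close> convergence on the boundary forces locally uniform convergence
  inside, so the boundary values determine the extension.\<close>

definition hardy_space :: "real \<Rightarrow> (complex \<Rightarrow> complex) set" where
  "hardy_space \<rho> = {f. f holomorphic_on annulus \<rho> \<and> f \<in> L2_boundary \<rho> \<and>
     (\<exists>h. (\<forall>n::nat. h n \<in> annulus_algebra \<rho>) \<and>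
          (\<lambda>n. arc_integral \<rho> (\<lambda>z. (norm (h n z - f z))\<^sup>2)) \<longlonglongrightarrow> 0 \<and>
          (\<forall>z\<in>annulus \<rho>. (\<lambda>n. h n z) \<longlonglongrightarrow> f z))}"

text \<open>The reproducing element for evaluation at \<open>a\<close>. As an element of \<open>L\<^sup>2\<close> it is only defined
  almost everywhere on the boundary; continuity selects its pointwise values there.\<close>

definition is_szego_function :: "real \<Rightarrow> complex \<Rightarrow> (complex \<Rightarrow> complex) \<Rightarrow> bool" where
  "is_szego_function \<rho> a k \<longleftrightarrow>
     k \<in> hardy_space \<rho> \<and>
     continuous_on (annulus \<rho> \<union> annulus_boundary \<rho>) k \<and>
     (\<forall>f\<in>hardy_space \<rho>. f a = boundary_inner \<rho> f k)"

text \<open>Values of \<open>k\<close> off the closed annulus are unconstrained, hence \<open>SOME\<close> rather than \<open>THE\<close>;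
  on the closed annulus \<open>k\<close> is unique.\<close>

definition szego_kernel :: "real \<Rightarrow> complex \<Rightarrow> complex \<Rightarrow> complex" where
  "szego_kernel \<rho> z a = (SOME k. is_szego_function \<rho> a k) z"

definition qpochhammer_inf :: "complex \<Rightarrow> real \<Rightarrow> complex" where
  "qpochhammer_inf \<alpha> q = (\<Prod>n. 1 - \<alpha> * of_real q ^ n)"

definition qGamma :: "real \<Rightarrow> complex \<Rightarrow> complex" where
  "qGamma q x =
     qpochhammer_inf (of_real q) q / qpochhammer_inf (of_real q powr x) q
       * of_real (1 - q) powr (1 - x)"

definition mtheta :: "complex \<Rightarrow> real \<Rightarrow> complex" where
  "mtheta x q = qpochhammer_inf x q * qpochhammer_inf (of_real q / x) q"

end

theory Submission
  imports Defs
begin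

text \<open>Write \<open>K\<close> for the theta quotient normalised to behave like \<open>1 / (1 - w)\<close> at its pole \<open>w = 1\<close>, and
let \<open>k z = K (cnj a * z) / (2\<pi>)\<close>. After the q-gamma values are rewritten as infinite products
(\<open>qGamma_theta_quotient\<close>), the asserted closed form is \<open>k\<close>, so it suffices that \<open>k\<close> is a
reproducing function for evaluation at \<open>a\<close> and that such a function is unique on the closed annulus.

The reproducing property is an instance of Cauchy's formula. On the unit circle \<open>cnj z = 1/z\<close>, and
on the circle of radius \<open>\<rho>\<close> it is \<open>\<rho>\<^sup>2/z\<close>. Since \<open>K\<close> commutes with conjugation and satisfies \<open>\<rho> * K (\<rho>\<^sup>2 * w) = - K w\<close> (\<open>theta_quotient_mult_rho_sq\<close>), on both
circles the conjugate of \<open>k\<close>, weighted by arc length, is therefore the boundary value of one and the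
same meromorphic function \<open>K (a/z) / (2\<pi>)\<close>, up to the sign that orients the boundary of the annulus.
The only pole of \<open>K (a/z)\<close> in the closed annulus is \<open>z = a\<close>, and there \<open>K (a/z) / z\<close> behaves like
\<open>1 / (z - a)\<close>. Hence the inner product of \<open>f\<close> with \<open>k\<close> is a Cauchy integral with value \<open>f a\<close>
(\<open>szego_theta_reproducing_algebra\<close>), for every \<open>f\<close> holomorphic in the annulus and continuous up to
the boundary. This uses the Cauchy formula for such functions (\<open>Cauchy_integral_annulus\<close>), obtained
by letting the radii of concentric circles tend to \<open>1\<close> and \<open>\<rho>\<close>. Square-mean convergence extends the
identity to the Hardy space.

Uniqueness (\<open>szego_function_unique\<close>): the difference of two reproducing functions is orthogonal to
both of them, hence to itself, so it vanishes on the boundary by continuity and inside by the maximum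
principle.\<close>

section \<open>Infinite q-products and the theta function\<close>

lemma convergent_prod_qpochhammer:
  fixes \<alpha> :: complex
  assumes "0 \<le> q" "q < 1"
  shows "convergent_prod (\<lambda>n. 1 - \<alpha> * of_real q ^ n)"
proof (intro abs_convergent_prod_imp_convergent_prod summable_imp_abs_convergent_prod)
  have "summable (\<lambda>n. norm \<alpha> * q ^ n)"
    using assms by (intro summable_mult summable_geometric) auto
  then show "summable (\<lambda>n. norm (1 - \<alpha> * of_real q ^ n - 1))"
    using assms by (simp add: norm_mult norm_power)
qed

lemma qpochhammer_inf_tendsto:
  assumes "0 \<le> q" "q < 1"
  shows "(\<lambda>N. \<Prod>n<N. 1 - \<alpha> * of_real q ^ n) \<longlonglongrightarrow> qpochhammer_inf \<alpha> q"
  using convergent_prod_LIMSEQ[OF convergent_prod_qpochhammer[OF assms, of \<alpha>]]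
  unfolding qpochhammer_inf_def by (subst LIMSEQ_lessThan_iff_atMost)

lemma qpochhammer_inf_split_head:
  assumes "0 \<le> q" "q < 1"
  shows "qpochhammer_inf \<alpha> q = (1 - \<alpha>) * qpochhammer_inf (of_real q * \<alpha>) q"
proof (rule LIMSEQ_unique)
  show "(\<lambda>N. \<Prod>n<Suc N. 1 - \<alpha> * of_real q ^ n) \<longlonglongrightarrow> qpochhammer_inf \<alpha> q"
    using qpochhammer_inf_tendsto[OF assms] by (rule LIMSEQ_Suc)
  have "(\<lambda>N. (1 - \<alpha>) * (\<Prod>n<N. 1 - of_real q * \<alpha> * of_real q ^ n)) 
          \<longlonglongrightarrow> (1 - \<alpha>) * qpochhammer_inf (of_real q * \<alpha>) q"
    by (intro tendsto_intros qpochhammer_inf_tendsto assms)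
  then show "(\<lambda>N. \<Prod>n<Suc N. 1 - \<alpha> * of_real q ^ n) 
          \<longlonglongrightarrow> (1 - \<alpha>) * qpochhammer_inf (of_real q * \<alpha>) q"
    by (subst prod.lessThan_Suc_shift) (simp add: mult_ac)
qed

lemma cnj_qpochhammer_inf:
  assumes "0 \<le> q" "q < 1"
  shows "cnj (qpochhammer_inf \<alpha> q) = qpochhammer_inf (cnj \<alpha>) q"
proof (rule LIMSEQ_unique)
  show "(\<lambda>N. cnj (\<Prod>n<N. 1 - \<alpha> * of_real q ^ n)) \<longlonglongrightarrow> cnj (qpochhammer_inf \<alpha> q)"
    by (intro tendsto_intros qpochhammer_inf_tendsto assms)
  show "(\<lambda>N. cnj (\<Prod>n<N. 1 - \<alpha> * of_real q ^ n)) \<longlonglongrightarrow> qpochhammer_inf (cnj \<alpha>) q"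
    using qpochhammer_inf_tendsto[OF assms, of "cnj \<alpha>"] by simp
qed

lemma qpochhammer_inf_nonzero:
  assumes "0 \<le> q" "q < 1" "norm \<alpha> < 1"
  shows "qpochhammer_inf \<alpha> q \<noteq> 0"
  unfolding qpochhammer_inf_def
proof (rule prodinf_nonzero)
  fix n
  have "norm (\<alpha> * of_real q ^ n) = norm \<alpha> * q ^ n"
    using assms by (simp add: norm_mult norm_power)
  also have "\<dots> \<le> norm \<alpha> * 1"
    using assms by (intro mult_left_mono power_le_one) auto
  finally have "norm (\<alpha> * of_real q ^ n) < 1"
    using assms by simp
  then show "1 - \<alpha> * of_real q ^ n \<noteq> 0"
    by auto
qed (rule convergent_prod_qpochhammer[OF assms(1,2)])

text \<open>On a disc of radius \<open>R\<close> the \<open>n\<close>-th factor differs from \<open>1\<close> by at most \<open>R q\<^sup>n\<close>. Some factors may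
vanish on the disc, so the argument is with partial products and not with sums of logarithms.\<close>

lemma uniform_limit_qpochhammer_inf:
  assumes "0 \<le> q" "q < 1"
  shows "uniform_limit (cball 0 R) (\<lambda>N \<alpha>. \<Prod>n<N. 1 - \<alpha> * of_real q ^ n)
           (\<lambda>\<alpha>. qpochhammer_inf \<alpha> q) sequentially"
proof -
  have "uniformly_convergent_on (cball 0 R) (\<lambda>N \<alpha>. \<Prod>n<N. 1 - \<alpha> * complex_of_real q ^ n)"
  proof (rule uniformly_convergent_on_prod')
    show "uniformly_convergent_on (cball 0 R)
            (\<lambda>N \<alpha>. \<Sum>n<N. norm (1 - \<alpha> * complex_of_real q ^ n - 1))"
    proof (rule Weierstrass_m_test')
      show "summable (\<lambda>n. R * q ^ n)"
        using assms by (intro summable_mult summable_geometric) auto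
      show "norm (norm (1 - \<alpha> * complex_of_real q ^ n - 1)) \<le> R * q ^ n"
        if "\<alpha> \<in> cball 0 R" for n \<alpha>
        using that assms by (auto simp: norm_mult norm_power intro: mult_right_mono)
    qed
  qed (auto intro!: continuous_intros)
  then obtain l where l: "uniform_limit (cball 0 R)
      (\<lambda>N \<alpha>. \<Prod>n<N. 1 - \<alpha> * complex_of_real q ^ n) l sequentially"
    by (auto simp: uniformly_convergent_on_def)
  have "l \<alpha> = qpochhammer_inf \<alpha> q" if "\<alpha> \<in> cball 0 R" for \<alpha>
    using tendsto_uniform_limitI[OF l that] qpochhammer_inf_tendsto[OF assms]
    by (rule LIMSEQ_unique)
  then show ?thesis
    by (intro uniform_limit_cong'[THEN iffD1, OF _ _ l]) auto
qed

lemma holomorphic_qpochhammer_inf: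
  assumes "0 \<le> q" "q < 1"
  shows "(\<lambda>\<alpha>. qpochhammer_inf \<alpha> q) holomorphic_on UNIV"
proof (rule holomorphic_uniform_sequence)
  fix x :: complex
  have "uniform_limit (cball x 1) (\<lambda>N \<alpha>. \<Prod>n<N. 1 - \<alpha> * complex_of_real q ^ n)
      (\<lambda>\<alpha>. qpochhammer_inf \<alpha> q) sequentially"
    by (rule uniform_limit_on_subset[OF uniform_limit_qpochhammer_inf[OF assms, of "norm x + 1"]])
       (simp add: cball_subset_cball_iff)
  then show "\<exists>d>0. cball x d \<subseteq> UNIV \<and> uniform_limit (cball x d)
      (\<lambda>N \<alpha>. \<Prod>n<N. 1 - \<alpha> * complex_of_real q ^ n) (\<lambda>\<alpha>. qpochhammer_inf \<alpha> q) sequentially"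
    by (intro exI[of _ 1]) auto
qed (auto intro!: holomorphic_intros)

lemma holomorphic_on_qpochhammer_inf [holomorphic_intros]:
  assumes "f holomorphic_on S" "0 \<le> q" "q < 1"
  shows "(\<lambda>z. qpochhammer_inf (f z) q) holomorphic_on S"
  using holomorphic_on_compose_gen[OF assms(1) holomorphic_qpochhammer_inf[OF assms(2,3)]]
  by (simp add: o_def)

lemma mtheta_factor_one:
  assumes "0 \<le> q" "q < 1"
  shows "mtheta x q = (1 - x) * (qpochhammer_inf (of_real q * x) q * qpochhammer_inf (of_real q / x) q)"
  using qpochhammer_inf_split_head[OF assms, of x] by (simp add: mtheta_def)

text \<open>Multiplying the argument by \<open>q\<close> removes the factor \<open>1 - x\<close> from the first product and adds the
factor \<open>1 - 1/x\<close> to the second; the quotient of the two factors is \<open>-1/x\<close>.\<close>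

lemma mtheta_mult_q:
  assumes "0 < q" "q < 1" "x \<noteq> 0"
  shows "mtheta (of_real q * x) q = - mtheta x q / x"
proof -
  have "qpochhammer_inf (1 / x) q = (1 - 1 / x) * qpochhammer_inf (of_real q / x) q"
    using qpochhammer_inf_split_head[of q "1 / x"] assms by simp
  then have "mtheta (of_real q * x) q
      = (1 - 1 / x) * (qpochhammer_inf (of_real q * x) q * qpochhammer_inf (of_real q / x) q)"
    using assms by (simp add: mtheta_def)
  also have "1 - 1 / x = - ((1 - x) / x)"
    using assms by (simp add: field_simps)
  finally show ?thesis
    using assms by (simp add: mtheta_factor_one[of q x])
qed

lemma cnj_mtheta:
  assumes "0 \<le> q" "q < 1"
  shows "cnj (mtheta x q) = mtheta (cnj x) q"
  using assms by (simp add: mtheta_def cnj_qpochhammer_inf)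

section \<open>The theta quotient\<close>

text \<open>The constant in front normalises the residue of the simple pole at \<open>1\<close>
(lemma \<open>theta_quotient_regular_one\<close>). As a function of \<open>w\<close> this is the sum of the bilateral series
with general term \<open>w\<^sup>n / (1 + \<rho>\<^bsup>2n+1\<^esup>)\<close>, continued analytically beyond its annulus of
convergence \<open>\<rho>\<^sup>2 < \<bar>w\<bar> < 1\<close>.\<close>

definition theta_quotient :: "real \<Rightarrow> complex \<Rightarrow> complex" where
  "theta_quotient \<rho> w =
     (qpochhammer_inf (of_real (\<rho>\<^sup>2)) (\<rho>\<^sup>2))\<^sup>2 / mtheta (- of_real \<rho>) (\<rho>\<^sup>2)
       * (mtheta (- of_real \<rho> * w) (\<rho>\<^sup>2) / mtheta w (\<rho>\<^sup>2))"

text \<open>The theta quotient times \<open>1 - w\<close>, with the factor \<open>1 - w\<close> of the denominator cancelled, so that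
the value at the pole \<open>w = 1\<close> is meaningful.\<close>

definition theta_quotient_regular :: "real \<Rightarrow> complex \<Rightarrow> complex" where
  "theta_quotient_regular \<rho> w =
     (qpochhammer_inf (of_real (\<rho>\<^sup>2)) (\<rho>\<^sup>2))\<^sup>2 / mtheta (- of_real \<rho>) (\<rho>\<^sup>2)
       * (mtheta (- of_real \<rho> * w) (\<rho>\<^sup>2)
         / (qpochhammer_inf (of_real (\<rho>\<^sup>2) * w) (\<rho>\<^sup>2) * qpochhammer_inf (of_real (\<rho>\<^sup>2) / w) (\<rho>\<^sup>2)))"

lemma mtheta_minus_rho:
  assumes "0 < \<rho>" "\<rho> < 1"
  shows "mtheta (- of_real \<rho>) (\<rho>\<^sup>2) = (qpochhammer_inf (- of_real \<rho>) (\<rho>\<^sup>2))\<^sup>2"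
  using assms by (simp add: mtheta_def power2_eq_square)

context
  fixes \<rho> :: real
  assumes \<rho>: "0 < \<rho>" "\<rho> < 1"
begin

lemma rho_sq: "0 \<le> \<rho>\<^sup>2" "\<rho>\<^sup>2 < 1" "0 < \<rho>\<^sup>2"
  using \<rho> by (auto simp: power_less_one_iff)

lemma theta_quotient_eq_regular:
  "theta_quotient \<rho> w = theta_quotient_regular \<rho> w / (1 - w)"
  unfolding theta_quotient_def theta_quotient_regular_def mtheta_factor_one[OF rho_sq(1,2), of w]
  by (simp add: divide_simps)

lemma theta_quotient_regular_one: "theta_quotient_regular \<rho> 1 = 1"
proof -
  have "qpochhammer_inf (of_real (\<rho>\<^sup>2)) (\<rho>\<^sup>2) \<noteq> 0" "qpochhammer_inf (- of_real \<rho>) (\<rho>\<^sup>2) \<noteq> 0"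
    using rho_sq \<rho> by (intro qpochhammer_inf_nonzero; simp add: norm_power)+
  then show ?thesis
    unfolding theta_quotient_regular_def mult_1_right div_by_1 mtheta_minus_rho[OF \<rho>]
    by (simp add: power2_eq_square[of "qpochhammer_inf _ _"])
qed

text \<open>The zeros of the theta function are the powers of \<open>\<rho>\<^sup>2\<close>; of these only \<open>1\<close> lies in the annulus
below, and its factor has been cancelled.\<close>

lemma holomorphic_theta_quotient_regular:
  "theta_quotient_regular \<rho> holomorphic_on {w. \<rho>\<^sup>2 < norm w \<and> norm w < 1 / \<rho>\<^sup>2}"
proof -
  have "qpochhammer_inf (of_real (\<rho>\<^sup>2) * w) (\<rho>\<^sup>2) \<noteq> 0 \<and> qpochhammer_inf (of_real (\<rho>\<^sup>2) / w) (\<rho>\<^sup>2) \<noteq> 0"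
    if "\<rho>\<^sup>2 < norm w" "norm w < 1 / \<rho>\<^sup>2" for w :: complex
  proof -
    have "norm w > 0"
      using that rho_sq by linarith
    then show ?thesis
      using that rho_sq \<rho>
      by (intro conjI qpochhammer_inf_nonzero) (auto simp: norm_mult norm_divide norm_power field_simps)
  qed
  moreover have "w \<noteq> 0" if "\<rho>\<^sup>2 < norm w" for w :: complex
    using that rho_sq by auto
  ultimately show ?thesis
    unfolding theta_quotient_regular_def mtheta_def
    using \<rho> rho_sq by (intro holomorphic_intros) auto
qed

lemma holomorphic_theta_quotient:
  "theta_quotient \<rho> holomorphic_on {w. \<rho>\<^sup>2 < norm w \<and> norm w < 1}"
proof -
  have "1 < 1 / \<rho>\<^sup>2"
    using rho_sq by simp
  then have "theta_quotient_regular \<rho> holomorphic_on {w. \<rho>\<^sup>2 < norm w \<and> norm w < 1}"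
    by (intro holomorphic_on_subset[OF holomorphic_theta_quotient_regular]) auto
  then have "(\<lambda>w. theta_quotient_regular \<rho> w / (1 - w)) holomorphic_on {w. \<rho>\<^sup>2 < norm w \<and> norm w < 1}"
    by (intro holomorphic_intros) auto
  then show ?thesis
    by (simp add: theta_quotient_eq_regular[abs_def])
qed

text \<open>The factor \<open>-1/w\<close> from the denominator and the factor \<open>1/(\<rho> w)\<close> from the numerator leave
\<open>-1/\<rho>\<close>. The minus sign is what turns the inner circle, with its weight \<open>\<rho>\<close> from arc length, into
the negatively oriented part of the boundary in Cauchy's formula.\<close>

lemma theta_quotient_mult_rho_sq:
  assumes "w \<noteq> 0"
  shows "of_real \<rho> * theta_quotient \<rho> (of_real (\<rho>\<^sup>2) * w) = - theta_quotient \<rho> w"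
proof -
  have "mtheta (- of_real \<rho> * (of_real (\<rho>\<^sup>2) * w)) (\<rho>\<^sup>2)
      = mtheta (- of_real \<rho> * w) (\<rho>\<^sup>2) / (of_real \<rho> * w)"
    using mtheta_mult_q[OF rho_sq(3,2), of "- of_real \<rho> * w"] assms \<rho> by (simp add: mult_ac)
  then show ?thesis
    unfolding theta_quotient_def mtheta_mult_q[OF rho_sq(3,2) assms]
    using assms \<rho> by simp
qed

lemma cnj_theta_quotient: "cnj (theta_quotient \<rho> w) = theta_quotient \<rho> (cnj w)"
  unfolding theta_quotient_def
  by (simp add: cnj_mtheta[OF rho_sq(1,2)] cnj_qpochhammer_inf[OF rho_sq(1,2)] 
      flip: of_real_power)

text \<open>The number \<open>lam\<close> is chosen so that \<open>(\<rho>\<^sup>2)\<^bsup>lam\<^esup> = \<rho> e\<^bsup>i\<pi>\<^esup> = -\<rho>\<close>. The powers of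
\<open>1 - \<rho>\<^sup>2\<close> then cancel, and the squared product in the denominator of the gamma function is the
value of the theta function at \<open>-\<rho>\<close>.\<close>

lemma qGamma_theta_quotient:
  assumes "lam = 1 / 2 + \<i> * of_real pi / (2 * of_real (ln \<rho>))"
  shows "(qGamma (\<rho>\<^sup>2) lam)\<^sup>2 / (2 * of_real pi * of_real (1 - \<rho>\<^sup>2) powr (2 * (1 - lam)))
           * (mtheta (- of_real \<rho> * w) (\<rho>\<^sup>2) / mtheta w (\<rho>\<^sup>2))
         = theta_quotient \<rho> w / (2 * of_real pi)"
proof -
  have "ln \<rho> \<noteq> 0"
    using \<rho> by simp
  have "of_real (\<rho>\<^sup>2) powr lam = exp (lam * of_real (ln (\<rho>\<^sup>2)))"
    using \<rho> by (simp add: powr_def Ln_of_real del: of_real_power)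
  also have "lam * of_real (ln (\<rho>\<^sup>2)) = of_real (ln \<rho>) + \<i> * of_real pi"
    using \<open>ln \<rho> \<noteq> 0\<close> \<rho> by (simp add: assms ln_realpow field_simps)
  also have "exp \<dots> = - of_real \<rho>"
    using \<rho> by (simp add: exp_add mult.commute[of \<i>] exp_of_real)
  finally have 1: "of_real (\<rho>\<^sup>2) powr lam = (- of_real \<rho> :: complex)" .
  have 2: "(of_real (1 - \<rho>\<^sup>2) powr (1 - lam))\<^sup>2 = (of_real (1 - \<rho>\<^sup>2) powr (2 * (1 - lam)) :: complex)"
    by (simp add: powr_def power2_eq_square[of "exp _"] algebra_simps flip: exp_add)
  have "of_real (1 - \<rho>\<^sup>2) \<noteq> (0 :: complex)"
    unfolding of_real_eq_0_iff using rho_sq by linarith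
  then have 3: "of_real (1 - \<rho>\<^sup>2) powr (2 * (1 - lam)) \<noteq> (0 :: complex)"
    by (simp add: powr_def del: of_real_diff of_real_power)
  show ?thesis
    unfolding qGamma_def 1 power_mult_distrib 2 power_divide theta_quotient_def mtheta_minus_rho[OF \<rho>]
    using 3 by simp
qed

end

section \<open>Cauchy integrals over the boundary of an annulus\<close>

text \<open>The integral is with respect to the angle; the factor \<open>r\<close> of arc length is not included.\<close>

definition circle_integral :: "real \<Rightarrow> (complex \<Rightarrow> 'b::banach) \<Rightarrow> 'b" where
  "circle_integral r f = integral {0..2*pi} (\<lambda>t. f (of_real r * cis t))"

lemma closed_annulus_eq:
  assumes "0 < \<rho>" "\<rho> < 1"
  shows "annulus \<rho> \<union> annulus_boundary \<rho> = {z. \<rho> \<le> norm z \<and> norm z \<le> 1}"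
  using assms by (auto simp: annulus_def annulus_boundary_def)

lemma open_annulus: "open (annulus \<rho>)"
proof -
  have "annulus \<rho> = - cball 0 \<rho> \<inter> ball 0 1"
    by (auto simp: annulus_def)
  then show ?thesis
    by auto
qed

lemma circle_integral_eq_contour_integral:
  "contour_integral (circlepath 0 r) f = \<i> * circle_integral r (\<lambda>z. f z * z)"
proof -
  have "contour_integral (circlepath 0 r) f
      = integral {0..2*pi} (\<lambda>t. f (0 + of_real r * cis t) * of_real r * \<i> * cis t)"
    unfolding circlepath_def by (rule contour_integral_part_circlepath_eq) simp
  also have "\<dots> = integral {0..2*pi} (\<lambda>t. \<i> * (f (of_real r * cis t) * (of_real r * cis t)))"
    by (simp add: mult_ac)
  finally show ?thesis
    unfolding circle_integral_def by (simp only: integral_mult_right)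
qed

text \<open>The radial segments between the two circles form a homotopy inside the annulus.\<close>

lemma contour_integral_concentric:
  assumes "f holomorphic_on annulus \<rho>" "0 < \<rho>" "\<rho> < r" "r < 1" "\<rho> < s" "s < 1"
  shows "contour_integral (circlepath 0 r) f = contour_integral (circlepath 0 s) f"
proof (rule Cauchy_theorem_homotopic_loops)
  show "homotopic_loops (annulus \<rho>) (circlepath 0 r) (circlepath 0 s)"
  proof (rule homotopic_loops_linear)
    fix t :: real
    define e where "e = exp (2 * of_real pi * \<i> * of_real t)"
    have e: "norm e = 1"
      by (simp add: e_def)
    show "closed_segment (circlepath 0 r t) (circlepath 0 s t) \<subseteq> annulus \<rho>"
    proof
      fix x assume "x \<in> closed_segment (circlepath 0 r t) (circlepath 0 s t)"
      then obtain u where u: "0 \<le> u" "u \<le> 1"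
          and x: "x = (1 - u) *\<^sub>R (of_real r * e) + u *\<^sub>R (of_real s * e)"
        by (auto simp: closed_segment_def circlepath e_def)
      have x': "x = of_real ((1 - u) * r + u * s) * e"
        unfolding x by (simp add: scaleR_conv_of_real algebra_simps)
      have "(1 - u) * r + u * s \<in> {\<rho><..<1}"
        using convexD[of "{\<rho><..<1}" r s "1 - u" u] u assms by simp
      then have "\<rho> < \<bar>(1 - u) * r + u * s\<bar> \<and> \<bar>(1 - u) * r + u * s\<bar> < 1"
        using \<open>0 < \<rho>\<close> by auto
      then show "x \<in> annulus \<rho>"
        unfolding annulus_def mem_Collect_eq x' norm_mult e norm_of_real by simp
    qed
  qed auto
qed (use assms open_annulus in auto)

lemma continuous_on_circle_integral:
  fixes f :: "complex \<Rightarrow> complex"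
  assumes "continuous_on {z. a \<le> norm z \<and> norm z \<le> b} f" "0 \<le> a"
  shows "continuous_on {a..b} (\<lambda>r. circle_integral r f)"
proof -
  have "continuous_on ({a..b} \<times> cbox 0 (2 * pi)) (\<lambda>(r, t). f (of_real r * cis t))"
    unfolding case_prod_unfold
    by (rule continuous_on_compose2[OF assms(1)])
       (use assms(2) in \<open>auto intro!: continuous_intros simp: norm_mult\<close>)
  from integral_continuous_on_param[OF this] show ?thesis
    by (simp add: circle_integral_def[abs_def])
qed

text \<open>On the open annulus the integral over a circle does not depend on the radius; uniform continuity on
the closed annulus makes it a continuous function of the radius up to both ends, so that the
constant value persists on the two boundary circles.\<close>

lemma circle_integral_Cauchy:
  assumes "f \<in> annulus_algebra \<rho>" "0 < \<rho>" "\<rho> < 1"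
  shows "circle_integral 1 (\<lambda>z. f z * z) = circle_integral \<rho> (\<lambda>z. f z * z)"
proof -
  have hol: "f holomorphic_on annulus \<rho>"
    and cont: "continuous_on {z. \<rho> \<le> norm z \<and> norm z \<le> 1} f"
    using assms by (auto simp: annulus_algebra_def closed_annulus_eq)
  define I where "I r = circle_integral r (\<lambda>z. f z * z)" for r
  define m where "m = (\<rho> + 1) / 2"
  have m: "\<rho> < m" "m < 1"
    using assms by (auto simp: m_def)
  have "continuous_on {\<rho>..1} I"
    unfolding I_def using cont assms
    by (intro continuous_on_circle_integral continuous_intros) auto
  then have "continuous_on (closure {\<rho><..<1}) I"
    using assms by simp
  moreover have "I r = I m" if "r \<in> {\<rho><..<1}" for r
    using contour_integral_concentric[OF hol \<open>0 < \<rho>\<close>, of r m] that m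
    by (simp add: I_def circle_integral_eq_contour_integral)
  ultimately have "I r = I m" if "r \<in> closure {\<rho><..<1}" for r
    using continuous_constant_on_closure[of "{\<rho><..<1}" I "I m" r] that by auto
  then show ?thesis
    using assms by (simp add: I_def)
qed

lemma circle_integral_Cauchy_kernel:
  assumes "norm a < 1" "0 < \<rho>" "\<rho> < norm a"
  shows "circle_integral 1 (\<lambda>z. z / (z - a)) = 2 * of_real pi"
    and "circle_integral \<rho> (\<lambda>z. z / (z - a)) = 0"
proof -
  have "((\<lambda>u. 1 / (u - a)) has_contour_integral 2 * of_real pi * \<i> * 1) (circlepath 0 1)"
    by (rule Cauchy_integral_circlepath_simple) (use assms in auto)
  from contour_integral_unique[OF this]
  show "circle_integral 1 (\<lambda>z. z / (z - a)) = 2 * of_real pi"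
    by (simp add: circle_integral_eq_contour_integral)
  have "((\<lambda>u. 1 / (u - a)) has_contour_integral 0) (circlepath 0 \<rho>)"
  proof (rule Cauchy_theorem_disc_simple)
    show "(\<lambda>u. 1 / (u - a)) holomorphic_on ball 0 (norm a)"
      by (intro holomorphic_intros) auto
  qed (use assms in auto)
  from contour_integral_unique[OF this]
  show "circle_integral \<rho> (\<lambda>z. z / (z - a)) = 0"
    by (simp add: circle_integral_eq_contour_integral)
qed

text \<open>Subtracting \<open>f a\<close> removes the pole of the Cauchy kernel, which reduces the Cauchy integral formula
for \<open>f\<close> to Cauchy's theorem for this function and the explicit integrals of the kernel.\<close>

lemma difference_quotient_annulus_algebra:
  assumes "f \<in> annulus_algebra \<rho>" "0 < \<rho>" "\<rho> < 1" "a \<in> annulus \<rho>"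
  shows "(\<lambda>z. if z = a then deriv f a else (f z - f a) / (z - a)) \<in> annulus_algebra \<rho>"
proof -
  let ?F = "\<lambda>z. if z = a then deriv f a else (f z - f a) / (z - a)"
  let ?C = "annulus \<rho> \<union> annulus_boundary \<rho>"
  have hol: "f holomorphic_on annulus \<rho>" and cont: "continuous_on ?C f"
    using assms by (auto simp: annulus_algebra_def)
  have F_hol: "?F holomorphic_on annulus \<rho>"
    by (rule pole_lemma_open[OF hol open_annulus])
  have "continuous (at z within ?C) ?F" if "z \<in> ?C" for z
  proof (cases "z = a")
    case True
    then have "z \<in> annulus \<rho>"
      using assms by simp
    then have "isCont ?F z"
      using holomorphic_on_imp_continuous_on[OF F_hol]
      unfolding continuous_on_eq_continuous_at[OF open_annulus] by blast
    then show ?thesis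
      using continuous_at_imp_continuous_at_within by blast
  next
    case False
    have "continuous (at z within ?C) (\<lambda>z. (f z - f a) / (z - a))"
      using False cont that
      by (intro continuous_intros) (auto simp: continuous_on_eq_continuous_within)
    moreover have "\<forall>\<^sub>F w in at z within ?C. (f w - f a) / (w - a) = ?F w"
      using eventually_neq_at_within[of a z ?C] by eventually_elim simp
    ultimately show ?thesis
      unfolding continuous_within using False by (auto elim!: Lim_transform_eventually)
  qed
  with F_hol show ?thesis
    by (auto simp: annulus_algebra_def continuous_on_eq_continuous_within)
qed

lemma continuous_on_circle:
  fixes f :: "complex \<Rightarrow> 'b::topological_space"
  assumes "continuous_on (annulus \<rho> \<union> annulus_boundary \<rho>) f" "0 < \<rho>" "r \<in> {1, \<rho>}"
  shows "continuous_on {0..2*pi} (\<lambda>t. f (of_real r * cis t))"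
  by (rule continuous_on_compose2[OF assms(1)])
     (use assms(2,3) in \<open>auto intro!: continuous_intros simp: annulus_boundary_def norm_mult\<close>)

lemma Cauchy_integral_annulus:
  assumes f: "f \<in> annulus_algebra \<rho>" and \<rho>: "0 < \<rho>" "\<rho> < 1" and a: "a \<in> annulus \<rho>"
  shows "circle_integral 1 (\<lambda>z. f z * z / (z - a)) - circle_integral \<rho> (\<lambda>z. f z * z / (z - a))
           = 2 * of_real pi * f a"
proof -
  let ?F = "\<lambda>z. if z = a then deriv f a else (f z - f a) / (z - a)"
  have a': "norm a < 1" "\<rho> < norm a"
    using a by (auto simp: annulus_def)
  have split: "circle_integral r (\<lambda>z. f z * z / (z - a))
      = circle_integral r (\<lambda>z. ?F z * z) + f a * circle_integral r (\<lambda>z. z / (z - a))"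
    if r: "r \<in> {1, \<rho>}" for r
  proof -
    have ne: "of_real r * cis t \<noteq> a" for t
    proof
      assume "of_real r * cis t = a"
      then have "norm (of_real r * cis t) = norm a"
        by simp
      then show False
        using r a' \<rho> by (auto simp: norm_mult)
    qed
    have "?F \<in> annulus_algebra \<rho>"
      by (rule difference_quotient_annulus_algebra[OF f \<rho> a])
    then have "continuous_on {0..2*pi} (\<lambda>t. ?F (of_real r * cis t) * (of_real r * cis t))"
      by (intro continuous_on_mult continuous_on_circle[OF _ \<rho>(1) r] continuous_intros)
         (auto simp: annulus_algebra_def)
    moreover have "continuous_on {0..2*pi} (\<lambda>t. f a * ((of_real r * cis t) / (of_real r * cis t - a)))"
      using ne by (intro continuous_intros) auto
    ultimately have "integral {0..2*pi} (\<lambda>t. ?F (of_real r * cis t) * (of_real r * cis t) 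
          + f a * ((of_real r * cis t) / (of_real r * cis t - a)))
        = integral {0..2*pi} (\<lambda>t. ?F (of_real r * cis t) * (of_real r * cis t))
          + integral {0..2*pi} (\<lambda>t. f a * ((of_real r * cis t) / (of_real r * cis t - a)))"
      by (intro integral_add integrable_continuous_real)
    moreover have "?F (of_real r * cis t) * (of_real r * cis t) 
          + f a * ((of_real r * cis t) / (of_real r * cis t - a))
          = f (of_real r * cis t) * (of_real r * cis t) / (of_real r * cis t - a)" for t
      using ne[of t] by (simp add: divide_simps) (simp add: algebra_simps)
    ultimately show ?thesis
      unfolding circle_integral_def by (simp only: integral_mult_right)
  qed
  have "circle_integral 1 (\<lambda>z. ?F z * z) = circle_integral \<rho> (\<lambda>z. ?F z * z)"
    by (intro circle_integral_Cauchy difference_quotient_annulus_algebra assms)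
  then show ?thesis
    using split[of 1] split[of \<rho>] circle_integral_Cauchy_kernel[OF a'(1) \<rho>(1) a'(2)]
    by (simp add: mult_ac)
qed

section \<open>Boundary integrals and the Hardy space\<close>

lemma arc_integral_continuous:
  fixes f :: "complex \<Rightarrow> 'b::euclidean_space"
  assumes "continuous_on (annulus \<rho> \<union> annulus_boundary \<rho>) f" "0 < \<rho>"
  shows "arc_integral \<rho> f = circle_integral 1 f + \<rho> *\<^sub>R circle_integral \<rho> f"
proof -
  have "integral\<^sup>L (lebesgue_on {0..2*pi}) (\<lambda>t. f (of_real r * cis t)) = circle_integral r f"
    if "r \<in> {1, \<rho>}" for r
    unfolding circle_integral_def
    by (intro lebesgue_integral_eq_integral continuous_imp_integrable_real continuous_on_circle[OF assms that]) auto
  from this[of 1] this[of \<rho>] show ?thesis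
    by (simp add: arc_integral_def)
qed

lemma arc_integral_diff:
  fixes f g :: "complex \<Rightarrow> 'b::euclidean_space"
  assumes "continuous_on (annulus \<rho> \<union> annulus_boundary \<rho>) f"
    and "continuous_on (annulus \<rho> \<union> annulus_boundary \<rho>) g" "0 < \<rho>"
  shows "arc_integral \<rho> (\<lambda>z. f z - g z) = arc_integral \<rho> f - arc_integral \<rho> g"
proof -
  have "circle_integral r (\<lambda>z. f z - g z) = circle_integral r f - circle_integral r g"
    if "r \<in> {1, \<rho>}" for r
    unfolding circle_integral_def
    by (intro integral_diff integrable_continuous_real continuous_on_circle[OF _ assms(3) that] assms)
  from this[of 1] this[of \<rho>] show ?thesis
    using assms by (simp add: arc_integral_continuous continuous_on_diff) (simp add: algebra_simps)
qed

lemma L2_boundary_continuous: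
  assumes "continuous_on (annulus \<rho> \<union> annulus_boundary \<rho>) f" "0 < \<rho>"
  shows "f \<in> L2_boundary \<rho>"
  unfolding L2_boundary_def mem_Collect_eq
proof (intro ballI conjI)
  fix r assume r: "r \<in> {1, \<rho>}"
  have "continuous_on {0..2*pi} (\<lambda>t. f (of_real r * cis t))"
    by (rule continuous_on_circle[OF assms r])
  then show "(\<lambda>t. f (of_real r * cis t)) \<in> borel_measurable (lebesgue_on {0..2*pi})"
      and "integrable (lebesgue_on {0..2*pi}) (\<lambda>t. (norm (f (of_real r * cis t)))\<^sup>2)"
    by (auto intro!: continuous_imp_measurable_on_sets_lebesgue continuous_imp_integrable_real
          continuous_intros)
qed

lemma annulus_algebra_subset_hardy_space:
  assumes "0 < \<rho>"
  shows "annulus_algebra \<rho> \<subseteq> hardy_space \<rho>"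
proof
  fix f assume f: "f \<in> annulus_algebra \<rho>"
  then have "f \<in> L2_boundary \<rho>"
    using assms by (auto simp: annulus_algebra_def intro: L2_boundary_continuous)
  moreover have "(\<lambda>n::nat. arc_integral \<rho> (\<lambda>z. (norm (f z - f z))\<^sup>2)) \<longlonglongrightarrow> 0"
    by (simp add: arc_integral_def)
  ultimately show "f \<in> hardy_space \<rho>"
    using f unfolding hardy_space_def
    by (auto simp: annulus_algebra_def intro!: exI[of _ "\<lambda>_. f"])
qed

text \<open>The Cauchy-Schwarz inequality against the constant \<open>1\<close>: it is the nonnegativity of the integral
of \<open>(m u - I)\<^sup>2\<close>, where \<open>m\<close> is the total mass and \<open>I\<close> the integral of \<open>u\<close>.\<close>

lemma (in finite_measure) integral_power2_le:
  fixes u :: "'a \<Rightarrow> real"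
  assumes u: "u \<in> borel_measurable M" and u2: "integrable M (\<lambda>x. (u x)\<^sup>2)"
  shows "integrable M u" "(integral\<^sup>L M u)\<^sup>2 \<le> measure M (space M) * (\<integral>x. (u x)\<^sup>2 \<partial>M)"
proof -
  show int: "integrable M u"
  proof (rule Bochner_Integration.integrable_bound)
    show "integrable M (\<lambda>x. 1 + (u x)\<^sup>2)"
      using u2 by auto
    have "\<bar>v\<bar> \<le> 1 + v\<^sup>2" for v :: real
      using zero_le_power2[of "\<bar>v\<bar> - 1 / 2"] by (simp add: power2_diff power_divide)
    then show "AE x in M. norm (u x) \<le> norm (1 + (u x)\<^sup>2)"
      by (auto simp: intro: order_trans)
  qed (use u in simp)
  define m where "m = measure M (space M)"
  define I where "I = integral\<^sup>L M u"
  have "0 \<le> (\<integral>x. (m * u x - I)\<^sup>2 \<partial>M)"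
    by simp
  also have "\<dots> = (\<integral>x. m\<^sup>2 * (u x)\<^sup>2 - 2 * m * I * u x + I\<^sup>2 \<partial>M)"
    by (intro Bochner_Integration.integral_cong) (auto simp: power2_eq_square algebra_simps)
  also have "\<dots> = m\<^sup>2 * (\<integral>x. (u x)\<^sup>2 \<partial>M) - 2 * m * I * I + I\<^sup>2 * m"
    using int u2 by (simp add: m_def I_def)
  also have "\<dots> = m * (m * (\<integral>x. (u x)\<^sup>2 \<partial>M) - I\<^sup>2)"
    by (simp add: power2_eq_square algebra_simps)
  finally have *: "0 \<le> m * (m * (\<integral>x. (u x)\<^sup>2 \<partial>M) - I\<^sup>2)" .
  show "(integral\<^sup>L M u)\<^sup>2 \<le> measure M (space M) * (\<integral>x. (u x)\<^sup>2 \<partial>M)"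
  proof (cases "m = 0")
    case True
    then have "emeasure M (space M) = 0"
      by (simp add: m_def emeasure_eq_measure)
    then have "AE x in M. u x = 0"
      by (intro AE_I[of _ _ "space M"]) auto
    then have "I = 0"
      unfolding I_def by (rule integral_eq_zero_AE)
    with True show ?thesis
      by (simp add: m_def I_def)
  next
    case False
    then have "m > 0"
      by (simp add: m_def zero_less_measure_iff)
    with * show ?thesis
      by (simp add: zero_le_mult_iff m_def I_def)
  qed
qed

lemma (in finite_measure) L2_tendsto_integral_mult:
  fixes f b :: "'a \<Rightarrow> complex" and h :: "nat \<Rightarrow> 'a \<Rightarrow> complex"
  assumes meas: "f \<in> borel_measurable M" "\<And>n. h n \<in> borel_measurable M" "b \<in> borel_measurable M"
    and sq: "integrable M (\<lambda>x. (norm (f x))\<^sup>2)" "\<And>n. integrable M (\<lambda>x. (norm (h n x))\<^sup>2)"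
    and b: "\<And>x. x \<in> space M \<Longrightarrow> norm (b x) \<le> B"
    and lim: "(\<lambda>n. \<integral>x. (norm (h n x - f x))\<^sup>2 \<partial>M) \<longlonglongrightarrow> 0"
  shows "(\<lambda>n. \<integral>x. h n x * b x \<partial>M) \<longlonglongrightarrow> (\<integral>x. f x * b x \<partial>M)"
proof -
  have int_mult: "integrable M (\<lambda>x. g x * b x)"
    if "g \<in> borel_measurable M" "integrable M (\<lambda>x. (norm (g x))\<^sup>2)" for g
  proof (rule Bochner_Integration.integrable_bound)
    show "integrable M (\<lambda>x. B * norm (g x))"
      using integral_power2_le(1)[of "\<lambda>x. norm (g x)"] that by auto
    show "AE x in M. norm (g x * b x) \<le> norm (B * norm (g x))"
      using b by (auto intro!: AE_I2 mult_right_mono order_trans[OF b] simp: norm_mult abs_mult mult.commute[of "norm (g _)"])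
  qed (use that meas in measurable)
  have norm_int_mult: "norm (\<integral>x. g x * b x \<partial>M) \<le> B * (\<integral>x. norm (g x) \<partial>M)"
    if "g \<in> borel_measurable M" "integrable M (\<lambda>x. (norm (g x))\<^sup>2)" for g
  proof -
    have "norm (\<integral>x. g x * b x \<partial>M) \<le> (\<integral>x. norm (g x * b x) \<partial>M)"
      by (rule integral_norm_bound)
    also have "\<dots> \<le> (\<integral>x. B * norm (g x) \<partial>M)"
    proof (rule integral_mono)
      show "integrable M (\<lambda>x. norm (g x * b x))"
        by (intro integrable_norm int_mult that)
      show "integrable M (\<lambda>x. B * norm (g x))"
        using integral_power2_le(1)[of "\<lambda>x. norm (g x)"] that by auto
    qed (use b in \<open>auto intro!: mult_right_mono simp: norm_mult mult.commute[of "norm (g _)"]\<close>)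
    finally show ?thesis
      by simp
  qed
  define u where "u n x = h n x - f x" for n x
  have u [measurable]: "u n \<in> borel_measurable M" for n
    unfolding u_def using meas by measurable
  have u_sq: "integrable M (\<lambda>x. (norm (u n x))\<^sup>2)" for n
  proof (rule Bochner_Integration.integrable_bound)
    show "integrable M (\<lambda>x. 2 * (norm (h n x))\<^sup>2 + 2 * (norm (f x))\<^sup>2)"
      using sq by auto
    have "(norm (v - w))\<^sup>2 \<le> 2 * (norm v)\<^sup>2 + 2 * (norm w)\<^sup>2" for v w :: complex
    proof -
      have "(norm (v - w))\<^sup>2 \<le> (norm v + norm w)\<^sup>2"
        by (intro power_mono norm_triangle_ineq4) auto
      then show ?thesis
        using zero_le_power2[of "norm v - norm w"] by (simp add: power2_sum power2_diff)
    qed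
    then show "AE x in M. norm ((norm (u n x))\<^sup>2) \<le> norm (2 * (norm (h n x))\<^sup>2 + 2 * (norm (f x))\<^sup>2)"
      by (simp add: u_def)
  qed measurable
  have "(\<lambda>n. \<integral>x. u n x * b x \<partial>M) \<longlonglongrightarrow> 0"
  proof (rule Lim_null_comparison)
    have "norm (\<integral>x. u n x * b x \<partial>M)
        \<le> \<bar>B\<bar> * sqrt (measure M (space M) * (\<integral>x. (norm (u n x))\<^sup>2 \<partial>M))" for n
    proof -
      have "norm (\<integral>x. u n x * b x \<partial>M) \<le> B * (\<integral>x. norm (u n x) \<partial>M)"
        by (rule norm_int_mult[OF u u_sq])
      also have "\<dots> \<le> \<bar>B\<bar> * (\<integral>x. norm (u n x) \<partial>M)"
        by (intro mult_right_mono) auto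
      also have "(\<integral>x. norm (u n x) \<partial>M) \<le> sqrt (measure M (space M) * (\<integral>x. (norm (u n x))\<^sup>2 \<partial>M))"
        using integral_power2_le(2)[OF _ u_sq] by (intro real_le_rsqrt) auto
      finally show ?thesis
        by (simp add: mult_left_mono)
    qed
    then show "\<forall>\<^sub>F n in sequentially. norm (\<integral>x. u n x * b x \<partial>M)
        \<le> \<bar>B\<bar> * sqrt (measure M (space M) * (\<integral>x. (norm (u n x))\<^sup>2 \<partial>M))"
      by auto
    have "(\<lambda>n. \<bar>B\<bar> * sqrt (measure M (space M) * (\<integral>x. (norm (u n x))\<^sup>2 \<partial>M)))
        \<longlonglongrightarrow> \<bar>B\<bar> * sqrt (measure M (space M) * 0)"
      using lim by (intro tendsto_intros) (simp add: u_def)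
    then show "(\<lambda>n. \<bar>B\<bar> * sqrt (measure M (space M) * (\<integral>x. (norm (u n x))\<^sup>2 \<partial>M))) \<longlonglongrightarrow> 0"
      by simp
  qed
  then have "(\<lambda>n. (\<integral>x. u n x * b x \<partial>M) + (\<integral>x. f x * b x \<partial>M)) \<longlonglongrightarrow> 0 + (\<integral>x. f x * b x \<partial>M)"
    by (intro tendsto_intros)
  moreover have "(\<integral>x. u n x * b x \<partial>M) + (\<integral>x. f x * b x \<partial>M) = (\<integral>x. h n x * b x \<partial>M)" for n
    using int_mult[OF u u_sq, of n] int_mult[OF meas(1) sq(1)]
    by (subst Bochner_Integration.integral_add[symmetric]) (auto simp: u_def algebra_simps)
  ultimately show ?thesis
    by simp
qed

text \<open>Since the weights \<open>1\<close> and \<open>\<rho>\<close> are positive, convergence to \<open>0\<close> of the integral over the whole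
boundary forces convergence in square mean on each circle separately.\<close>

lemma boundary_inner_tendsto:
  assumes \<rho>: "0 < \<rho>"
    and h: "\<And>n. h n \<in> annulus_algebra \<rho>" and f: "f \<in> L2_boundary \<rho>"
    and lim: "(\<lambda>n. arc_integral \<rho> (\<lambda>z. (norm (h n z - f z))\<^sup>2)) \<longlonglongrightarrow> 0"
    and k: "continuous_on (annulus \<rho> \<union> annulus_boundary \<rho>) k"
  shows "(\<lambda>n. boundary_inner \<rho> (h n) k) \<longlonglongrightarrow> boundary_inner \<rho> f k"
proof -
  let ?M = "lebesgue_on {0..2*pi}"
  interpret M: finite_measure ?M
    by (rule finite_measure_lebesgue_on) auto
  define J where "J r n = (\<integral>t. (norm (h n (of_real r * cis t) - f (of_real r * cis t)))\<^sup>2 \<partial>?M)" for r n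
  have J_nonneg: "0 \<le> J r n" for r n
    by (simp add: J_def)
  have J_sum: "(\<lambda>n. J 1 n + \<rho> * J \<rho> n) \<longlonglongrightarrow> 0"
    using lim by (simp add: arc_integral_def J_def)
  have "J 1 \<longlonglongrightarrow> 0"
    by (rule tendsto_sandwich[OF _ _ tendsto_const J_sum]) (use J_nonneg \<rho> in auto)
  moreover have "(\<lambda>n. \<rho> * J \<rho> n) \<longlonglongrightarrow> 0"
    by (rule tendsto_sandwich[OF _ _ tendsto_const J_sum]) (use J_nonneg \<rho> in auto)
  then have "(\<lambda>n. inverse \<rho> * (\<rho> * J \<rho> n)) \<longlonglongrightarrow> inverse \<rho> * 0"
    by (intro tendsto_intros)
  then have "J \<rho> \<longlonglongrightarrow> 0"
    using \<rho> by simp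
  ultimately have J: "J r \<longlonglongrightarrow> 0" if "r \<in> {1, \<rho>}" for r
    using that by auto
  have "(\<lambda>n. \<integral>t. h n (of_real r * cis t) * cnj (k (of_real r * cis t)) \<partial>?M)
      \<longlonglongrightarrow> (\<integral>t. f (of_real r * cis t) * cnj (k (of_real r * cis t)) \<partial>?M)" if r: "r \<in> {1, \<rho>}" for r
  proof -
    have k_cont: "continuous_on {0..2*pi} (\<lambda>t. cnj (k (of_real r * cis t)))"
      by (intro continuous_intros continuous_on_circle[OF k \<rho> r])
    then have "bounded ((\<lambda>t. cnj (k (of_real r * cis t))) ` {0..2*pi})"
      by (intro compact_imp_bounded compact_continuous_image) auto
    then obtain B where B: "norm (cnj (k (of_real r * cis t))) \<le> B" if "t \<in> {0..2*pi}" for t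
      unfolding bounded_iff by blast
    have h_L2: "h n \<in> L2_boundary \<rho>" for n
      using h[of n] \<rho> by (auto simp: annulus_algebra_def intro: L2_boundary_continuous)
    show ?thesis
    proof (rule M.L2_tendsto_integral_mult)
      show "(\<lambda>t. cnj (k (of_real r * cis t))) \<in> borel_measurable ?M"
        using k_cont by (intro continuous_imp_measurable_on_sets_lebesgue) auto
      show "norm (cnj (k (of_real r * cis t))) \<le> B" if "t \<in> space ?M" for t
        using B that by auto
      show "(\<lambda>n. \<integral>t. (norm (h n (of_real r * cis t) - f (of_real r * cis t)))\<^sup>2 \<partial>?M) \<longlonglongrightarrow> 0"
        using J[OF r] by (simp add: J_def[abs_def])
    qed (use f h_L2 r in \<open>auto simp: L2_boundary_def\<close>)
  qed
  from this[of 1] this[of \<rho>] show ?thesis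
    unfolding boundary_inner_def arc_integral_def by (auto intro!: tendsto_intros)
qed

section \<open>The reproducing property of the theta quotient\<close>

definition szego_theta :: "real \<Rightarrow> complex \<Rightarrow> complex \<Rightarrow> complex" where
  "szego_theta \<rho> a z = theta_quotient \<rho> (cnj a * z) / (2 * of_real pi)"

lemma szego_theta_annulus_algebra:
  assumes \<rho>: "0 < \<rho>" "\<rho> < 1" and a: "a \<in> annulus \<rho>"
  shows "szego_theta \<rho> a \<in> annulus_algebra \<rho>"
proof -
  have img: "\<rho>\<^sup>2 < norm (cnj a * z) \<and> norm (cnj a * z) < 1" if "\<rho> \<le> norm z" "norm z \<le> 1" for z
  proof -
    have a': "\<rho> < norm a" "norm a < 1"
      using a by (auto simp: annulus_def)
    have "\<rho> * \<rho> < norm a * norm z"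
      using a' that \<rho> by (intro mult_less_le_imp_less) auto
    moreover have "norm a * norm z \<le> norm a * 1"
      using that by (intro mult_left_mono) auto
    ultimately show ?thesis
      using a' by (simp add: norm_mult power2_eq_square)
  qed
  have "theta_quotient \<rho> \<circ> (\<lambda>z. cnj a * z) holomorphic_on annulus \<rho>"
    using img by (intro holomorphic_on_compose_gen[OF _ holomorphic_theta_quotient[OF \<rho>]])
      (auto intro!: holomorphic_intros simp: annulus_def)
  then have "szego_theta \<rho> a holomorphic_on annulus \<rho>"
    unfolding szego_theta_def[abs_def] by (intro holomorphic_intros) (auto simp: o_def)
  moreover have "continuous_on (annulus \<rho> \<union> annulus_boundary \<rho>) (szego_theta \<rho> a)"
    unfolding szego_theta_def[abs_def] closed_annulus_eq[OF \<rho>]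
    using img
    by (intro continuous_intros continuous_on_compose2[OF holomorphic_on_imp_continuous_on[OF holomorphic_theta_quotient[OF \<rho>]]])
       auto
  ultimately show ?thesis
    by (simp add: annulus_algebra_def)
qed

text \<open>On the unit circle \<open>cnj z = 1/z\<close>, so the conjugate kernel is the boundary value of the meromorphic
function \<open>z \<mapsto> theta_quotient \<rho> (a/z) / (2\<pi>)\<close>. The factor
\<open>z / (z - a)\<close>, which is \<open>1 / (1 - a/z)\<close>, becomes the Cauchy kernel because \<open>dt = dz / (iz)\<close>.\<close>

lemma cnj_szego_theta_outer:
  assumes \<rho>: "0 < \<rho>" "\<rho> < 1" and z: "norm z = 1"
  shows "cnj (szego_theta \<rho> a z) = theta_quotient_regular \<rho> (a / z) * z / (z - a) / (2 * of_real pi)"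
proof -
  have "z \<noteq> 0"
    using z by auto
  have "z * cnj z = 1"
    using z by (simp flip: complex_norm_square)
  then have "cnj z = 1 / z"
    using \<open>z \<noteq> 0\<close> by (simp add: field_simps)
  then have "cnj (szego_theta \<rho> a z) = theta_quotient \<rho> (a / z) / (2 * of_real pi)"
    by (simp add: szego_theta_def cnj_theta_quotient[OF \<rho>])
  also have "\<dots> = theta_quotient_regular \<rho> (a / z) / (1 - a / z) / (2 * of_real pi)"
    by (simp add: theta_quotient_eq_regular[OF \<rho>])
  also have "1 - a / z = (z - a) / z"
    using \<open>z \<noteq> 0\<close> by (simp add: field_simps)
  finally show ?thesis
    by simp
qed

text \<open>On the inner circle \<open>cnj z = \<rho>\<^sup>2/z\<close>, and the functional equation brings back the same meromorphic
function as on the unit circle, with the opposite sign.\<close>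

lemma cnj_szego_theta_inner:
  assumes \<rho>: "0 < \<rho>" "\<rho> < 1" and z: "norm z = \<rho>" and a: "a \<noteq> 0"
  shows "of_real \<rho> * cnj (szego_theta \<rho> a z)
           = - (theta_quotient_regular \<rho> (a / z) * z / (z - a) / (2 * of_real pi))"
proof -
  have "z \<noteq> 0"
    using z \<rho> by auto
  have "z * cnj z = of_real (\<rho>\<^sup>2)"
    using z by (simp flip: complex_norm_square)
  then have "cnj z = of_real (\<rho>\<^sup>2) / z"
    using \<open>z \<noteq> 0\<close> by (simp add: field_simps)
  then have "cnj (szego_theta \<rho> a z)
      = theta_quotient \<rho> (of_real (\<rho>\<^sup>2) * (a / z)) / (2 * of_real pi)"
    by (simp add: szego_theta_def cnj_theta_quotient[OF \<rho>] mult_ac)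
  then have "of_real \<rho> * cnj (szego_theta \<rho> a z)
      = of_real \<rho> * theta_quotient \<rho> (of_real (\<rho>\<^sup>2) * (a / z)) / (2 * of_real pi)"
    by simp
  also have "\<dots> = - theta_quotient \<rho> (a / z) / (2 * of_real pi)"
    using \<open>z \<noteq> 0\<close> a by (subst theta_quotient_mult_rho_sq[OF \<rho>]) auto
  also have "\<dots> = - (theta_quotient_regular \<rho> (a / z) / (1 - a / z) / (2 * of_real pi))"
    by (simp add: theta_quotient_eq_regular[OF \<rho>])
  also have "1 - a / z = (z - a) / z"
    using \<open>z \<noteq> 0\<close> by (simp add: field_simps)
  finally show ?thesis
    by simp
qed

text \<open>By the two preceding lemmas the inner product is the Cauchy integral over both boundary circles, at
the point \<open>a\<close>, of the function \<open>G\<close> below, and \<open>G a = f a\<close>.\<close>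

lemma szego_theta_reproducing_algebra:
  assumes \<rho>: "0 < \<rho>" "\<rho> < 1" and a: "a \<in> annulus \<rho>" and f: "f \<in> annulus_algebra \<rho>"
  shows "boundary_inner \<rho> f (szego_theta \<rho> a) = f a"
proof -
  have a': "\<rho> < norm a" "norm a < 1" "a \<noteq> 0"
    using a \<rho> by (auto simp: annulus_def)
  define G where "G z = f z * theta_quotient_regular \<rho> (a / z)" for z
  let ?C = "{z::complex. \<rho> \<le> norm z \<and> norm z \<le> 1}"
  have f_hol: "f holomorphic_on annulus \<rho>" and f_cont: "continuous_on ?C f"
    using f by (auto simp: annulus_algebra_def closed_annulus_eq[OF \<rho>])
  have img: "\<rho>\<^sup>2 < norm (a / z) \<and> norm (a / z) < 1 / \<rho>\<^sup>2 \<and> z \<noteq> 0"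
    if "\<rho> \<le> norm z" "norm z \<le> 1" for z
  proof -
    have z: "norm z > 0"
      using that \<rho> by linarith
    have "\<rho>\<^sup>2 * norm z \<le> \<rho>\<^sup>2 * 1"
      using that by (intro mult_left_mono) auto
    also have "\<rho>\<^sup>2 * 1 < \<rho> * 1"
      using \<rho> by (simp add: power2_eq_square)
    finally have "\<rho>\<^sup>2 * norm z < norm a"
      using a' by simp
    moreover have "\<rho>\<^sup>2 * norm a < norm z"
    proof -
      have "\<rho>\<^sup>2 * norm a \<le> \<rho>\<^sup>2 * 1"
        using a' by (intro mult_left_mono) auto
      also have "\<rho>\<^sup>2 * 1 < \<rho> * 1"
        using \<rho> by (simp add: power2_eq_square)
      finally show ?thesis
        using that by simp
    qed
    ultimately show ?thesis
      using z \<rho> by (auto simp: norm_divide field_simps)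
  qed
  have "theta_quotient_regular \<rho> \<circ> (\<lambda>z. a / z) holomorphic_on annulus \<rho>"
    using img \<rho> by (intro holomorphic_on_compose_gen[OF _ holomorphic_theta_quotient_regular[OF \<rho>]])
      (auto intro!: holomorphic_intros simp: annulus_def)
  then have "G holomorphic_on annulus \<rho>"
    unfolding G_def[abs_def] using f_hol by (intro holomorphic_intros) (auto simp: o_def)
  moreover have reg_cont: "continuous_on ?C (\<lambda>z. theta_quotient_regular \<rho> (a / z))"
    using img
    by (intro continuous_on_compose2[OF holomorphic_on_imp_continuous_on[OF holomorphic_theta_quotient_regular[OF \<rho>]]] continuous_intros)
       auto
  then have "continuous_on ?C G"
    unfolding G_def[abs_def] using f_cont by (intro continuous_intros)
  ultimately have "G \<in> annulus_algebra \<rho>"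
    by (simp add: annulus_algebra_def closed_annulus_eq[OF \<rho>])
  note Cauchy = Cauchy_integral_annulus[OF this \<rho> a]
  have "continuous_on ?C (\<lambda>z. f z * cnj (szego_theta \<rho> a z))"
    using szego_theta_annulus_algebra[OF \<rho> a] f_cont
    by (auto intro!: continuous_intros simp: annulus_algebra_def closed_annulus_eq[OF \<rho>])
  then have "boundary_inner \<rho> f (szego_theta \<rho> a)
      = circle_integral 1 (\<lambda>z. f z * cnj (szego_theta \<rho> a z))
        + of_real \<rho> * circle_integral \<rho> (\<lambda>z. f z * cnj (szego_theta \<rho> a z))"
    unfolding boundary_inner_def
    by (subst arc_integral_continuous) (auto simp: closed_annulus_eq[OF \<rho>] \<rho> scaleR_conv_of_real)
  also have "circle_integral 1 (\<lambda>z. f z * cnj (szego_theta \<rho> a z))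
      = circle_integral 1 (\<lambda>z. 1 / (2 * of_real pi) * (G z * z / (z - a)))"
    unfolding circle_integral_def
    by (intro integral_cong) (simp add: cnj_szego_theta_outer[OF \<rho>] G_def mult_ac)
  also have "\<dots> = 1 / (2 * of_real pi) * circle_integral 1 (\<lambda>z. G z * z / (z - a))"
    unfolding circle_integral_def by (simp only: integral_mult_right)
  also have "of_real \<rho> * circle_integral \<rho> (\<lambda>z. f z * cnj (szego_theta \<rho> a z))
      = circle_integral \<rho> (\<lambda>z. - 1 / (2 * of_real pi) * (G z * z / (z - a)))"
    unfolding circle_integral_def integral_mult_right[symmetric]
  proof (intro integral_cong)
    fix t :: real
    define w where "w = of_real \<rho> * cis t"
    have w: "norm w = \<rho>"
      using \<rho> by (simp add: w_def norm_mult)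
    have "of_real \<rho> * (f w * cnj (szego_theta \<rho> a w)) = f w * (of_real \<rho> * cnj (szego_theta \<rho> a w))"
      by (simp add: mult_ac)
    also have "\<dots> = - 1 / (2 * of_real pi) * (G w * w / (w - a))"
      unfolding cnj_szego_theta_inner[OF \<rho> w a'(3)] by (simp add: G_def mult_ac)
    finally show "of_real \<rho> * (f (of_real \<rho> * cis t) * cnj (szego_theta \<rho> a (of_real \<rho> * cis t)))
        = - 1 / (2 * of_real pi) * (G (of_real \<rho> * cis t) * (of_real \<rho> * cis t) / (of_real \<rho> * cis t - a))"
      by (simp add: w_def)
  qed
  also have "\<dots> = - 1 / (2 * of_real pi) * circle_integral \<rho> (\<lambda>z. G z * z / (z - a))"
    unfolding circle_integral_def by (simp only: integral_mult_right)
  also have "1 / (2 * of_real pi) * circle_integral 1 (\<lambda>z. G z * z / (z - a))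
        + - 1 / (2 * of_real pi) * circle_integral \<rho> (\<lambda>z. G z * z / (z - a))
      = 1 / (2 * of_real pi) * (2 * of_real pi * G a)"
    unfolding Cauchy[symmetric] by (simp add: diff_divide_distrib)
  also have "\<dots> = f a"
    using a' by (simp add: G_def theta_quotient_regular_one[OF \<rho>])
  finally show ?thesis .
qed

text \<open>Both sides of the reproducing identity are continuous along the approximating sequence that defines
membership in the Hardy space.\<close>

lemma is_szego_function_szego_theta:
  assumes \<rho>: "0 < \<rho>" "\<rho> < 1" and a: "a \<in> annulus \<rho>"
  shows "is_szego_function \<rho> a (szego_theta \<rho> a)"
  unfolding is_szego_function_def
proof (intro conjI ballI)
  have k: "szego_theta \<rho> a \<in> annulus_algebra \<rho>"
    by (rule szego_theta_annulus_algebra[OF assms])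
  then show "szego_theta \<rho> a \<in> hardy_space \<rho>"
    using annulus_algebra_subset_hardy_space[OF \<rho>(1)] by blast
  show cont: "continuous_on (annulus \<rho> \<union> annulus_boundary \<rho>) (szego_theta \<rho> a)"
    using k by (simp add: annulus_algebra_def)
  fix f assume "f \<in> hardy_space \<rho>"
  then obtain h where f: "f \<in> L2_boundary \<rho>" and h: "\<And>n::nat. h n \<in> annulus_algebra \<rho>"
    and lim: "(\<lambda>n. arc_integral \<rho> (\<lambda>z. (norm (h n z - f z))\<^sup>2)) \<longlonglongrightarrow> 0"
    and pt: "(\<lambda>n. h n a) \<longlonglongrightarrow> f a"
    using a unfolding hardy_space_def by blast
  have "(\<lambda>n. boundary_inner \<rho> (h n) (szego_theta \<rho> a)) \<longlonglongrightarrow> boundary_inner \<rho> f (szego_theta \<rho> a)"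
    by (rule boundary_inner_tendsto[OF \<rho>(1) h f lim cont])
  then have "(\<lambda>n. h n a) \<longlonglongrightarrow> boundary_inner \<rho> f (szego_theta \<rho> a)"
    by (simp add: szego_theta_reproducing_algebra[OF assms h])
  with pt show "f a = boundary_inner \<rho> f (szego_theta \<rho> a)"
    by (rule LIMSEQ_unique)
qed

section \<open>Uniqueness of the kernel\<close>

lemma arc_integral_norm_sq_eq_0_imp_boundary:
  fixes d :: "complex \<Rightarrow> complex"
  assumes cont: "continuous_on (annulus \<rho> \<union> annulus_boundary \<rho>) d" and \<rho>: "0 < \<rho>"
    and zero: "arc_integral \<rho> (\<lambda>z. (norm (d z))\<^sup>2) = 0" and z: "z \<in> annulus_boundary \<rho>"
  shows "d z = 0"
proof -
  let ?N = "\<lambda>r. circle_integral r (\<lambda>z. (norm (d z))\<^sup>2)"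
  have N_nonneg: "?N r \<ge> 0" if "r \<in> {1, \<rho>}" for r
    unfolding circle_integral_def
    using continuous_on_circle[OF cont \<rho> that]
    by (intro integral_nonneg integrable_continuous_real continuous_intros) auto
  have "?N 1 + \<rho> * ?N \<rho> = 0"
    using zero cont \<rho> by (subst (asm) arc_integral_continuous) (auto intro!: continuous_intros)
  moreover have "\<rho> * ?N \<rho> \<ge> 0"
    using N_nonneg \<rho> by simp
  ultimately have "?N 1 = 0" "\<rho> * ?N \<rho> = 0"
    using N_nonneg[of 1] by (simp_all add: add_nonneg_eq_0_iff)
  then have N_zero: "?N r = 0" if "r \<in> {1, \<rho>}" for r
    using that \<rho> by auto
  define r where "r = norm z"
  have r: "r \<in> {1, \<rho>}"
    using z \<rho> by (auto simp: r_def annulus_boundary_def)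
  have "\<forall>t\<in>{0..2*pi}. (norm (d (of_real r * cis t)))\<^sup>2 = 0"
    using N_zero[OF r] continuous_on_circle[OF cont \<rho> r] unfolding circle_integral_def
    by (subst (asm) integral_eq_0_iff) (auto intro!: continuous_intros)
  moreover have "z = of_real r * cis (Arg2pi z)" "Arg2pi z \<in> {0..2*pi}"
    using Arg2pi[of z] by (auto simp: r_def cis_conv_exp is_Arg_def)
  ultimately show ?thesis
    by (metis norm_eq_zero zero_eq_power2)
qed

text \<open>Applying both reproducing identities to \<open>k\<close> and to \<open>l\<close> gives \<open>\<langle>d, d\<rangle> = 0\<close> for \<open>d = k - l\<close>. By
continuity \<open>d\<close> vanishes everywhere on the boundary, and by the maximum principle also inside.\<close>

lemma szego_function_unique:
  assumes \<rho>: "0 < \<rho>" "\<rho> < 1"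
    and k: "is_szego_function \<rho> a k" and l: "is_szego_function \<rho> a l"
    and z: "z \<in> annulus \<rho> \<union> annulus_boundary \<rho>"
  shows "k z = l z"
proof -
  let ?C = "annulus \<rho> \<union> annulus_boundary \<rho>"
  have cont: "continuous_on ?C k" "continuous_on ?C l"
    and hol: "k holomorphic_on annulus \<rho>" "l holomorphic_on annulus \<rho>"
    using k l by (auto simp: is_szego_function_def hardy_space_def)
  have rep: "f a = boundary_inner \<rho> f k \<and> f a = boundary_inner \<rho> f l" if "f \<in> {k, l}" for f
    using k l that by (auto simp: is_szego_function_def)
  define d where "d z = k z - l z" for z
  have d_cont: "continuous_on ?C d"
    unfolding d_def[abs_def] by (intro continuous_intros cont)
  have rep_d: "boundary_inner \<rho> f d = 0" if f: "f \<in> {k, l}" for f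
  proof -
    have "continuous_on ?C f"
      using f cont by auto
    then have "boundary_inner \<rho> f d = boundary_inner \<rho> f k - boundary_inner \<rho> f l"
      unfolding boundary_inner_def d_def complex_cnj_diff right_diff_distrib
      by (intro arc_integral_diff continuous_intros cont \<rho>)
    then show ?thesis
      using rep[OF f] by (metis right_minus_eq)
  qed
  have "boundary_inner \<rho> d d = boundary_inner \<rho> k d - boundary_inner \<rho> l d"
    unfolding boundary_inner_def d_def left_diff_distrib[of "k _" "l _"]
    by (intro arc_integral_diff continuous_intros cont \<rho>)
  then have "boundary_inner \<rho> d d = 0"
    using rep_d by simp
  moreover have "boundary_inner \<rho> d d = of_real (arc_integral \<rho> (\<lambda>z. (norm (d z))\<^sup>2))"
    by (simp add: boundary_inner_def arc_integral_def complex_norm_square[symmetric] scaleR_conv_of_real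
        del: of_real_power flip: integral_complex_of_real)
  ultimately have "arc_integral \<rho> (\<lambda>z. (norm (d z))\<^sup>2) = 0"
    by simp
  then have boundary: "d z = 0" if "z \<in> annulus_boundary \<rho>" for z
    using arc_integral_norm_sq_eq_0_imp_boundary[OF d_cont \<rho>(1) _ that] by simp
  let ?S = "{z::complex. \<rho> \<le> norm z \<and> norm z \<le> 1}"
  have S: "?S = cball 0 1 - ball 0 \<rho>"
    by auto
  have closed: "closed ?S"
    unfolding S by (intro closed_Diff) auto
  have interior: "interior ?S = annulus \<rho>"
    unfolding S using \<rho> by (auto simp: interior_diff annulus_def)
  have "norm (d z) \<le> 0"
  proof (rule maximum_modulus_frontier[where f = d and S = ?S])
    show "d holomorphic_on interior ?S"
      unfolding interior d_def[abs_def] by (intro holomorphic_intros hol)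
    show "continuous_on (closure ?S) d"
      using d_cont closed by (simp add: closed_annulus_eq[OF \<rho>])
    show "bounded ?S"
      unfolding S by (rule bounded_subset[OF bounded_cball]) auto
    show "norm (d w) \<le> 0" if "w \<in> frontier ?S" for w
    proof -
      have "w \<in> ?S - annulus \<rho>"
        using that unfolding frontier_def interior closure_closed[OF closed] .
      then have "w \<in> annulus_boundary \<rho>"
        using closed_annulus_eq[OF \<rho>] by blast
      then show ?thesis
        by (simp add: boundary)
    qed
    show "z \<in> ?S"
      using z by (simp add: closed_annulus_eq[OF \<rho>])
  qed
  then show ?thesis
    by (simp add: d_def)
qed

section \<open>The closed form of the Szego kernel\<close>

theorem mainTheorem2:
  fixes \<rho> :: real and lam a z :: complex
  assumes "0 < \<rho>" and "\<rho> < 1"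
    and "lam = 1 / 2 + \<i> * of_real pi / (2 * of_real (ln \<rho>))"
    and "a \<in> annulus \<rho>" and "z \<in> annulus \<rho> \<union> annulus_boundary \<rho>"
  shows "szego_kernel \<rho> z a =
           (qGamma (\<rho>\<^sup>2) lam)\<^sup>2 / (2 * of_real pi * of_real (1 - \<rho>\<^sup>2) powr (2 * (1 - lam)))
           * (mtheta (- of_real \<rho> * cnj a * z) (\<rho>\<^sup>2) / mtheta (cnj a * z) (\<rho>\<^sup>2))"
proof -
  have theta: "is_szego_function \<rho> a (szego_theta \<rho> a)"
    by (rule is_szego_function_szego_theta[OF assms(1,2,4)])
  then have "is_szego_function \<rho> a (SOME k. is_szego_function \<rho> a k)"
    by (rule someI[of "is_szego_function \<rho> a"])
  then have "szego_kernel \<rho> z a = szego_theta \<rho> a z"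
    unfolding szego_kernel_def by (rule szego_function_unique[OF assms(1,2) _ theta assms(5)])
  then show ?thesis
    using qGamma_theta_quotient[OF assms(1-3), of "cnj a * z"]
    by (simp add: szego_theta_def mult.assoc)
qed

end
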